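(* Let $w$ be a weight function. Then for each $f \in C^1(\overline{\Omega}_H)$, $$| f(a_k) - \widetilde{\Pi}_h f(a_k) | \leq (h + r_\sigma) | f |_{C^1} + \{ 2 c_1(a_k) + 2 c_2(a_k) \} | f |_{C^0},$$ where $$c_1(a_k) := \frac{ \| w(a_k - \cdot) \|_{L^1(\sigma_k \setminus B_\delta(a_k))} }{ \| w(a_k - \cdot) \|_{L^1(B_h(a_k) \setminus B_\delta(a_k))} }, \qquad c_2(a_k) := \frac{ \pi L_w r_\sigma h^2 }{ \| w(a_k - \cdot) \|_{L^1(B_h(a_k) \setminus \sigma_k)} }.$$
   Context: Setting. $B_r(x) = \{ y \in \mathbb{R}^2 : |x-y| < r \}$, $B_{r,\ell}(x) = \{ y \in \mathbb{R}^2 : \ell < |y-x| < r \}$, $B_r = B_r(0)$, $B_{r,\ell} = B_{r,\ell}(0)$. Fix a bounded domain $\Omega \subset \mathbb{R}^2$ and $H>0$, and let $\Omega_H = \{ x \in \mathbb{R}^2 : |x-y| < H \text{ for some } y \in \Omega \}$. Let $N \in \mathbb{N}$ and let $a_1, \dots, a_N \in \Omega_H$ be pairwise distinct. For each $i$ let $\sigma_i = \{ x \in \Omega_H : |x-a_i| < |x-a_j| \text{ for all } j \neq i \}$ (Voronoi cell), and let $r_\sigma = \max_{1\le i\le N} \max_{y \in \overline{\sigma}_i} |y-a_i|$. Assume $r_\sigma < H$. Fix $h$ (the influence radius) with $r_\sigma < h < H$, fix $k \in \{1,\dots,N\}$ with $a_k \in \sigma_k \cap \Omega$, and fix $\delta>0$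 with $B_\delta(a_k) \subset \sigma_k \cap \Omega$. Assume $B_{h+r_\sigma}(x) \subset \Omega_H$ for each $x \in B_\delta(a_k)$. For $x \in B_\delta(a_k)$ and $\rho>0$ let $\mathcal{R}(x,\rho) = \{ i : 0 \le |x-a_i| < \rho \} \setminus \{k\}$, and let $V_i(x) = \int_{\sigma_i \cap B_{h,\delta}(x)} 1 \, dy$. Norms. $|f|_{C^0} = \max_{\overline{\Omega}_H} |f|$, $|f|_{C^j} = \max_{|\alpha|=j} |D^\alpha f|_{C^0}$; $\|g\|_{L^1(U)} = \int_U |g(y)|\,dy$; $w(a_k-\cdot)$ denotes $y \mapsto w(a_k-y)$. Weight function. A function $w \in L^\infty(\mathbb{R}^2) \cap C(\overline{B}_{h,\delta})$ is a weight function if: (i) $w(x) \ge 0$ for almost all $x \in \mathbb{R}^2$; (ii) $w(x)=0$ for almost all $x \in \mathbb{R}^2 \setminus \overline{B}_{h,\delta}$; (iii) there is $L_w \ge 0$ with $|w(x)-w(y)| \le L_w|x-y|$ for all $x,y \in B_{h,\delta}$ (this $L_w$ is the constant used below); (iv) there is $\widehat{w} \in L^1(\delta,h)$ with $w(x) = \widehat{w}(|x|)$ for almost all $x \in B_{h,\delta}$; (v) there is $C_0>0$ such that for each $x \in B_\delta(a_k)$, $\sum_{i \in \mathcal{R}(x,h)} \int_{\sigma_i} w(x-y)\,dy \ge C_0$ and $\sum_{j \in \mathcal{R}(x,h)} V_j(x) w(x-a_j) \ge C_0$. Operator. For $f \in C(\overline{\Omega}_H)$, $$\widetilde{\Pi}_h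 f(a_k) = \frac{ \sum_{i \in \mathcal{R}(a_k,h)} V_i(a_k) f(a_i) w(a_k-a_i) }{ \sum_{j \in \mathcal{R}(a_k,h)} V_j(a_k) w(a_k-a_j) }.$$
   Formalization: The seminorm |f|_{C^1} is taken as the maximum over all unit directions, i.e. the maximum of the Euclidean norm of the gradient, instead of over the two coordinate partial derivatives, since with the latter the inequality fails (by a constant factor, for fine square grids). *)

theory Defs
  imports "HOL-Analysis.Analysis"
begin

definition annulus :: "real \<Rightarrow> real \<Rightarrow> real^2 \<Rightarrow> (real^2) set" where
  "annulus r l x = {y. l < norm (y - x) \<and> norm (y - x) < r}"

definition enlarge :: "(real^2) set \<Rightarrow> real \<Rightarrow> (real^2) set" where
  "enlarge \<Omega> H = {x. \<exists>y\<in>\<Omega>. norm (x - y) < H}"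

(* Particles are a 1, ..., a N.  In the following definitions D is the enlarged domain. *)

definition voronoi :: "(real^2) set \<Rightarrow> nat \<Rightarrow> (nat \<Rightarrow> real^2) \<Rightarrow> nat \<Rightarrow> (real^2) set" where
  "voronoi D N a i =
     {x\<in>D. \<forall>j\<in>{1..N}. j \<noteq> i \<longrightarrow> norm (x - a i) < norm (x - a j)}"

(* For bounded D and pairwise distinct particles in D the closed cells are compact and
   nonempty, so that the supremum is a maximum. *)
definition cell_radius :: "(real^2) set \<Rightarrow> nat \<Rightarrow> (nat \<Rightarrow> real^2) \<Rightarrow> real" where
  "cell_radius D N a =
     Max ((\<lambda>i. SUP y\<in>closure (voronoi D N a i). norm (y - a i)) ` {1..N})"

definition neighbours ::
  "nat \<Rightarrow> (nat \<Rightarrow> real^2) \<Rightarrow> nat \<Rightarrow> real^2 \<Rightarrow> real \<Rightarrow> nat set" where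
  "neighbours N a k x \<rho> = {i\<in>{1..N}. 0 \<le> norm (x - a i) \<and> norm (x - a i) < \<rho>} - {k}"

definition particle_volume ::
  "(real^2) set \<Rightarrow> nat \<Rightarrow> (nat \<Rightarrow> real^2) \<Rightarrow> real \<Rightarrow> real \<Rightarrow> nat \<Rightarrow> real^2 \<Rightarrow> real" where
  "particle_volume D N a h \<delta> i x =
     (LINT y : voronoi D N a i \<inter> annulus h \<delta> x | lebesgue. 1)"

(* Here w is a fixed representative: it is continuous on the closed annulus, and w (a k - a i)
   is a point value.  The constant Lw of the Lipschitz condition is an argument because the
   error estimate refers to it. *)
definition weight_function ::
  "(real^2) set \<Rightarrow> nat \<Rightarrow> (nat \<Rightarrow> real^2) \<Rightarrow> nat \<Rightarrow> real \<Rightarrow> real \<Rightarrow> real \<Rightarrow> (real^2 \<Rightarrow> real) \<Rightarrow> bool"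
  where
  "weight_function D N a k h \<delta> Lw w \<longleftrightarrow>
     w \<in> borel_measurable lebesgue \<and> (\<exists>M. AE x in lebesgue. \<bar>w x\<bar> \<le> M) \<and>
     continuous_on (closure (annulus h \<delta> 0)) w \<and>
     (AE x in lebesgue. 0 \<le> w x) \<and>
     (AE x in lebesgue. x \<notin> closure (annulus h \<delta> 0) \<longrightarrow> w x = 0) \<and>
     Lw-lipschitz_on (annulus h \<delta> 0) w \<and>
     (\<exists>v::real \<Rightarrow> real. set_integrable lebesgue {\<delta><..<h} v \<and>
        (AE x in lebesgue. x \<in> annulus h \<delta> 0 \<longrightarrow> w x = v (norm x))) \<and>
     (\<exists>C0>0. \<forall>x\<in>ball (a k) \<delta>.
        (\<Sum>i\<in>neighbours N a k x h. LINT y : voronoi D N a i | lebesgue. w (x - y)) \<ge> C0 \<and>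
        (\<Sum>j\<in>neighbours N a k x h. particle_volume D N a h \<delta> j x * w (x - a j)) \<ge> C0)"

definition approx_op ::
  "(real^2) set \<Rightarrow> nat \<Rightarrow> (nat \<Rightarrow> real^2) \<Rightarrow> nat \<Rightarrow> real \<Rightarrow> real \<Rightarrow> (real^2 \<Rightarrow> real) \<Rightarrow>
    (real^2 \<Rightarrow> real) \<Rightarrow> real" where
  "approx_op D N a k h \<delta> w f =
     (\<Sum>i\<in>neighbours N a k (a k) h. particle_volume D N a h \<delta> i (a k) * f (a i) * w (a k - a i)) /
     (\<Sum>j\<in>neighbours N a k (a k) h. particle_volume D N a h \<delta> j (a k) * w (a k - a j))"

definition L1_norm :: "(real^2) set \<Rightarrow> (real^2 \<Rightarrow> real) \<Rightarrow> real" where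
  "L1_norm U g = (LINT y : U | lebesgue. \<bar>g y\<bar>)"

definition C0_norm :: "(real^2) set \<Rightarrow> (real^2 \<Rightarrow> real) \<Rightarrow> real" where
  "C0_norm D f = (SUP x\<in>closure D. \<bar>f x\<bar>)"

(* Functions that are C1 in the open set D and whose first derivatives extend
   continuously to the closure of D. *)
definition C1_closure :: "(real^2) set \<Rightarrow> (real^2 \<Rightarrow> real) \<Rightarrow> bool" where
  "C1_closure D f \<longleftrightarrow>
     continuous_on (closure D) f \<and> (\<forall>x\<in>D. f differentiable (at x)) \<and>
     (\<forall>\<alpha>. \<exists>g. continuous_on (closure D) g \<and> (\<forall>x\<in>D. g x = frechet_derivative f (at x) \<alpha>))"

(* The derivative of f in direction \<alpha>; the limit yields the continuous extension to the
   boundary of D. *)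
definition deriv_ext ::
  "(real^2) set \<Rightarrow> real^2 \<Rightarrow> (real^2 \<Rightarrow> real) \<Rightarrow> real^2 \<Rightarrow> real" where
  "deriv_ext D \<alpha> f x = Lim (at x within D) (\<lambda>y. frechet_derivative f (at y) \<alpha>)"

(* The maximum over norm \<alpha> = 1 runs over all unit directions, which gives the maximum of the
   Euclidean norm of the gradient.  With the two coordinate directions only (\<alpha> \<in> Basis), the
   mean value estimate \<bar>f x - f y\<bar> \<le> norm (x - y) * C1_norm D f holds only up to a
   factor sqrt 2, and the error estimate fails: for fine square grids, weights concentrated
   near norm x = h and f a smoothing of x \<mapsto> \<bar>x $ 1\<bar> + \<bar>x $ 2\<bar>, the error is close to
   4 / pi * h while the bound is close to h. *)
definition C1_norm :: "(real^2) set \<Rightarrow> (real^2 \<Rightarrow> real) \<Rightarrow> real" where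
  "C1_norm D f = (SUP \<alpha>\<in>{\<alpha>. norm \<alpha> = 1}. C0_norm D (deriv_ext D \<alpha> f))"

definition c1_const ::
  "(real^2) set \<Rightarrow> nat \<Rightarrow> (nat \<Rightarrow> real^2) \<Rightarrow> nat \<Rightarrow> real \<Rightarrow> real \<Rightarrow> (real^2 \<Rightarrow> real) \<Rightarrow> real"
  where
  "c1_const D N a k h \<delta> w =
     L1_norm (voronoi D N a k - ball (a k) \<delta>) (\<lambda>y. w (a k - y)) /
     L1_norm (ball (a k) h - ball (a k) \<delta>) (\<lambda>y. w (a k - y))"

definition c2_const ::
  "(real^2) set \<Rightarrow> nat \<Rightarrow> (nat \<Rightarrow> real^2) \<Rightarrow> nat \<Rightarrow> real \<Rightarrow> real \<Rightarrow> (real^2 \<Rightarrow> real) \<Rightarrow> real"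
  where
  "c2_const D N a k h Lw w =
     pi * Lw * cell_radius D N a * h\<^sup>2 /
     L1_norm (ball (a k) h - voronoi D N a k) (\<lambda>y. w (a k - y))"

end

theory Submission
  imports Defs
begin

text \<open>
  The operator returns a weighted mean of the values \<open>f (a i)\<close>, because the same coefficients
  \<open>V i * w (a k - a i)\<close> occur in its numerator and in its denominator. The coefficients are
  nonnegative and their sum is positive by the last condition on a weight function, so that
  the error is at most the largest deviation \<open>\<bar>f (a k) - f (a i)\<bar>\<close> over the neighbours
  (\<open>weighted_mean_deviation\<close>). Neighbours lie within distance \<open>h\<close> of \<open>a k\<close>, in a disc
  contained in the domain, and the mean value inequality bounds each deviation by \<open>h\<close> times
  the \<open>C1\<close> seminorm (\<open>C1_norm_mean_value\<close>). As the terms with \<open>r\<sigma>\<close>, \<open>c1_const\<close> and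
  \<open>c2_const\<close> are nonnegative, the estimate follows.

  Two points need care. The weight is nonnegative only almost everywhere, while its values at
  the points \<open>a k - a i\<close> matter: these points lie in the open annulus, where continuity
  excludes negative values (\<open>nonneg_of_AE_nonneg\<close>). Moreover the seminorm is a supremum of
  suprema, and it dominates the derivatives only if both families are bounded. This follows
  from compactness of the closure and from the fact that the derivative in any unit direction
  is controlled by finitely many coordinate derivatives (\<open>deriv_ext_uniform_bound\<close>).
\<close>

section \<open>Weighted means and pointwise signs\<close>

lemma weighted_mean_deviation:
  fixes p g :: "'i \<Rightarrow> real"
  assumes p: "\<And>i. i \<in> I \<Longrightarrow> 0 \<le> p i"
    and pos: "0 < sum p I"
    and dev: "\<And>i. i \<in> I \<Longrightarrow> \<bar>c - g i\<bar> \<le> B"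
  shows "\<bar>c - (\<Sum>i\<in>I. p i * g i) / sum p I\<bar> \<le> B"
proof -
  have "\<bar>\<Sum>i\<in>I. p i * (c - g i)\<bar> \<le> (\<Sum>i\<in>I. p i * B)"
    by (rule order_trans[OF sum_abs]) (auto intro!: sum_mono mult_left_mono simp: abs_mult p dev)
  also have "\<dots> = B * sum p I"
    by (simp add: sum_distrib_left mult.commute)
  finally have "\<bar>\<Sum>i\<in>I. p i * (c - g i)\<bar> / sum p I \<le> B"
    using pos by (simp add: divide_le_eq)
  moreover have "c - (\<Sum>i\<in>I. p i * g i) / sum p I = (\<Sum>i\<in>I. p i * (c - g i)) / sum p I"
    using pos by (simp add: field_simps sum_subtractf sum_distrib_left)
  ultimately show ?thesis
    using pos by (simp add: abs_divide)
qed

text \<open>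
  The points of \<open>S\<close> at which \<open>w\<close> is negative form an open null set, hence the empty set.
\<close>

lemma nonneg_of_AE_nonneg:
  fixes w :: "'a::euclidean_space \<Rightarrow> real"
  assumes "open S" "continuous_on S w" "AE x in lebesgue. 0 \<le> w x" "x \<in> S"
  shows "0 \<le> w x"
proof (rule ccontr)
  assume "\<not> 0 \<le> w x"
  let ?U = "{y \<in> S. w y < 0}"
  have "open ?U"
    using continuous_on_open_vimage[OF assms(1), THEN iffD1, OF assms(2), rule_format, of "{..<0}"]
    by (simp add: vimage_def Int_def conj_commute)
  moreover have "?U \<noteq> {}"
    using \<open>\<not> 0 \<le> w x\<close> \<open>x \<in> S\<close> by auto
  moreover have "negligible ?U"
  proof -
    obtain Z where "Z \<in> null_sets lebesgue" "{y. \<not> 0 \<le> w y} \<subseteq> Z"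
      using assms(3) by (auto simp: eventually_ae_filter)
    then show ?thesis
      using negligible_subset[of Z ?U] by (force simp: negligible_iff_null_sets)
  qed
  ultimately show False
    using open_not_negligible by blast
qed

section \<open>Supremum norms and the mean value inequality\<close>

lemma C0_norm_upper:
  assumes "\<And>x. x \<in> closure D \<Longrightarrow> \<bar>f x\<bar> \<le> M" "x \<in> closure D"
  shows "\<bar>f x\<bar> \<le> C0_norm D f"
  unfolding C0_norm_def using assms by (intro cSUP_upper bdd_aboveI2) auto

lemma continuous_on_closure_bound:
  fixes f :: "'a::heine_borel \<Rightarrow> real"
  assumes "continuous_on (closure D) f" "bounded D"
  shows "\<exists>M. \<forall>x\<in>closure D. \<bar>f x\<bar> \<le> M"
proof -
  have "compact (f ` closure D)"
    using assms by (intro compact_continuous_image) auto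
  then show ?thesis
    by (auto dest!: compact_imp_bounded simp: bounded_iff)
qed

lemma C0_norm_nonneg:
  assumes "continuous_on (closure D) f" "bounded D" "D \<noteq> {}"
  shows "0 \<le> C0_norm D f"
proof -
  obtain M where "\<And>x. x \<in> closure D \<Longrightarrow> \<bar>f x\<bar> \<le> M"
    using continuous_on_closure_bound[OF assms(1,2)] by blast
  moreover obtain x where "x \<in> closure D"
    using assms(3) closure_subset by blast
  ultimately show ?thesis
    using C0_norm_upper[of D f M x] by (smt (verit))
qed

lemma nontrivial_limit_within_open_closure:
  fixes D :: "'a::euclidean_space set"
  assumes "open D" "x \<in> closure D"
  shows "\<not> trivial_limit (at x within D)"
proof -
  have "x islimpt D"
    using assms by (metis closure_def UnE mem_Collect_eq interior_limit_point interior_open)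
  then show ?thesis
    by (simp add: trivial_limit_within)
qed

lemma deriv_ext_eqI:
  assumes "open D" "continuous_on (closure D) g"
    and "\<And>x. x \<in> D \<Longrightarrow> g x = frechet_derivative f (at x) \<alpha>"
    and "x \<in> closure D"
  shows "deriv_ext D \<alpha> f x = g x"
proof -
  have "(g \<longlongrightarrow> g x) (at x within D)"
    using assms(2,4) closure_subset by (meson continuous_on_def tendsto_within_subset)
  moreover have "\<forall>\<^sub>F y in at x within D. g y = frechet_derivative f (at y) \<alpha>"
    using assms(3) by (auto simp: eventually_at_filter)
  ultimately have "((\<lambda>y. frechet_derivative f (at y) \<alpha>) \<longlongrightarrow> g x) (at x within D)"
    by (rule Lim_transform_eventually)
  then show ?thesis
    unfolding deriv_ext_def
    using nontrivial_limit_within_open_closure[OF assms(1,4)] by (intro tendsto_Lim)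
qed

lemma C1_closure_deriv_ext:
  assumes "C1_closure D f" "open D"
  shows "continuous_on (closure D) (deriv_ext D \<alpha> f)"
    and "x \<in> D \<Longrightarrow> deriv_ext D \<alpha> f x = frechet_derivative f (at x) \<alpha>"
proof -
  obtain g where g: "continuous_on (closure D) g"
      "\<And>x. x \<in> D \<Longrightarrow> g x = frechet_derivative f (at x) \<alpha>"
    using assms(1) unfolding C1_closure_def by metis
  have eq: "deriv_ext D \<alpha> f y = g y" if "y \<in> closure D" for y
    using deriv_ext_eqI[OF assms(2) g that] .
  show "continuous_on (closure D) (deriv_ext D \<alpha> f)"
    by (rule continuous_on_eq[OF g(1)]) (simp add: eq)
  show "x \<in> D \<Longrightarrow> deriv_ext D \<alpha> f x = frechet_derivative f (at x) \<alpha>"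
    using eq g(2) closure_subset[of D] by auto
qed

text \<open>
  Compactness bounds the derivative in each single direction, with a constant that depends on
  the direction. Linearity in the direction makes the sum of the constants of the coordinate
  directions a common bound inside \<open>D\<close>, and continuity carries it over to the closure.
\<close>

lemma deriv_ext_uniform_bound:
  assumes f: "C1_closure D f" and D: "open D" "bounded D"
  obtains M where "\<And>\<alpha> x. norm \<alpha> = 1 \<Longrightarrow> x \<in> closure D \<Longrightarrow> \<bar>deriv_ext D \<alpha> f x\<bar> \<le> M"
proof -
  note ext = C1_closure_deriv_ext[OF f D(1)]
  have "\<exists>M. \<forall>x\<in>closure D. \<bar>deriv_ext D \<alpha> f x\<bar> \<le> M" for \<alpha>
    using ext(1) D(2) by (rule continuous_on_closure_bound)
  then obtain m where m: "\<And>\<alpha> x. x \<in> closure D \<Longrightarrow> \<bar>deriv_ext D \<alpha> f x\<bar> \<le> m \<alpha>"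
    by metis
  have inner: "\<bar>deriv_ext D \<alpha> f x\<bar> \<le> sum m Basis" if "norm \<alpha> = 1" "x \<in> D" for \<alpha> x
  proof -
    let ?L = "frechet_derivative f (at x)"
    have "linear ?L"
      using f \<open>x \<in> D\<close> by (auto simp: C1_closure_def intro: linear_frechet_derivative)
    then have "?L \<alpha> = (\<Sum>b\<in>Basis. (\<alpha> \<bullet> b) * ?L b)"
      by (subst euclidean_representation[of \<alpha>, symmetric]) (simp add: linear_sum linear_scale)
    also have "\<bar>\<dots>\<bar> \<le> (\<Sum>b\<in>Basis. m b)"
    proof (rule order_trans[OF sum_abs sum_mono])
      fix b :: "real^2"
      assume "b \<in> Basis"
      then have "\<bar>\<alpha> \<bullet> b\<bar> \<le> 1"
        using Basis_le_norm[of b \<alpha>] that(1) by simp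
      moreover have "\<bar>?L b\<bar> \<le> m b"
        using m[of x b] ext(2)[OF \<open>x \<in> D\<close>, of b] \<open>x \<in> D\<close> closure_subset[of D] by auto
      ultimately show "\<bar>(\<alpha> \<bullet> b) * ?L b\<bar> \<le> m b"
        using mult_mono[of "\<bar>\<alpha> \<bullet> b\<bar>" 1 "\<bar>?L b\<bar>" "m b"] by (simp add: abs_mult)
    qed
    finally show ?thesis
      using ext(2)[OF \<open>x \<in> D\<close>] by simp
  qed
  have "\<bar>deriv_ext D \<alpha> f x\<bar> \<le> sum m Basis" if "norm \<alpha> = 1" "x \<in> closure D" for \<alpha> x
    using continuous_on_closure_norm_le[OF ext(1)] inner that by (metis real_norm_def)
  with that show thesis
    by blast
qed

lemma directional_derivative_le_C1_norm:
  assumes f: "C1_closure D f" and D: "open D" "bounded D"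
    and "norm \<alpha> = 1" "x \<in> D"
  shows "\<bar>frechet_derivative f (at x) \<alpha>\<bar> \<le> C1_norm D f"
proof -
  obtain M where M:
      "\<And>\<alpha> x. norm \<alpha> = 1 \<Longrightarrow> x \<in> closure D \<Longrightarrow> \<bar>deriv_ext D \<alpha> f x\<bar> \<le> M"
    using deriv_ext_uniform_bound[OF f D] by blast
  have x: "x \<in> closure D"
    using \<open>x \<in> D\<close> closure_subset by blast
  have "\<bar>deriv_ext D \<alpha> f x\<bar> \<le> C0_norm D (deriv_ext D \<alpha> f)"
    using M[OF \<open>norm \<alpha> = 1\<close>] x by (rule C0_norm_upper)
  also have "\<dots> \<le> C1_norm D f"
    unfolding C1_norm_def
  proof (rule cSUP_upper)
    show "bdd_above ((\<lambda>\<beta>. C0_norm D (deriv_ext D \<beta> f)) ` {\<beta>. norm \<beta> = 1})"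
      unfolding C0_norm_def using M x by (intro bdd_aboveI2[of _ _ M] cSUP_least) auto
  qed (use \<open>norm \<alpha> = 1\<close> in simp)
  finally show ?thesis
    using C1_closure_deriv_ext(2)[OF f D(1) \<open>x \<in> D\<close>] by simp
qed

lemma C1_norm_nonneg:
  assumes "C1_closure D f" "open D" "bounded D" "D \<noteq> {}"
  shows "0 \<le> C1_norm D f"
proof -
  obtain x where "x \<in> D"
    using assms(4) by blast
  moreover obtain \<alpha> :: "real^2" where "norm \<alpha> = 1"
    using vector_choose_size[of 1] by auto
  ultimately show ?thesis
    using directional_derivative_le_C1_norm[OF assms(1-3)] abs_ge_zero order_trans by blast
qed

lemma C1_norm_mean_value:
  assumes f: "C1_closure D f" and D: "open D" "bounded D"
    and S: "convex S" "S \<subseteq> D" "x \<in> S" "y \<in> S"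
  shows "\<bar>f x - f y\<bar> \<le> C1_norm D f * norm (x - y)"
proof -
  have der: "(f has_derivative frechet_derivative f (at z)) (at z)" if "z \<in> S" for z
    using f S(2) that by (auto simp: C1_closure_def frechet_derivative_works[symmetric])
  have "onorm (frechet_derivative f (at z)) \<le> C1_norm D f" if z: "z \<in> S" for z
  proof (rule onorm_le)
    fix v :: "real^2"
    interpret L: linear "frechet_derivative f (at z)"
      using der[OF z] by (rule has_derivative_linear)
    show "norm (frechet_derivative f (at z) v) \<le> C1_norm D f * norm v"
    proof (cases "v = 0")
      case True
      then show ?thesis by (simp add: L.zero)
    next
      case False
      then have "\<bar>frechet_derivative f (at z) (v /\<^sub>R norm v)\<bar> \<le> C1_norm D f"
        using S(2) z by (intro directional_derivative_le_C1_norm[OF f D]) auto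
      then show ?thesis
        using False by (simp add: L.scaleR abs_mult field_simps)
    qed
  qed
  then have "norm (f x - f y) \<le> C1_norm D f * norm (x - y)"
    using der S by (intro differentiable_bound) (auto intro: has_derivative_at_withinI)
  then show ?thesis
    by simp
qed

section \<open>Geometry of the particles\<close>

lemma enlarge_eq_UN_ball: "enlarge \<Omega> H = (\<Union>y\<in>\<Omega>. ball y H)"
  by (auto simp: enlarge_def dist_norm norm_minus_commute)

lemma open_enlarge: "open (enlarge \<Omega> H)"
  by (auto simp: enlarge_eq_UN_ball)

lemma bounded_enlarge:
  assumes "bounded \<Omega>"
  shows "bounded (enlarge \<Omega> H)"
proof -
  obtain B where B: "\<And>y. y \<in> \<Omega> \<Longrightarrow> norm y \<le> B"
    using assms by (auto simp: bounded_iff)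
  have "norm x \<le> B + H" if x: "x \<in> enlarge \<Omega> H" for x
  proof -
    obtain y where "y \<in> \<Omega>" "norm (x - y) < H"
      using x unfolding enlarge_def by blast
    then show ?thesis
      using B[of y] norm_triangle_sub[of x y] by linarith
  qed
  then show ?thesis
    by (auto simp: bounded_iff)
qed

lemma cell_radius_nonneg:
  assumes "bounded D" "k \<in> {1..N}" "a k \<in> voronoi D N a k"
  shows "0 \<le> cell_radius D N a"
proof -
  have "bounded (closure (voronoi D N a k))"
    using assms(1) by (intro bounded_closure) (auto intro: bounded_subset simp: voronoi_def)
  then obtain B where "\<And>y. y \<in> closure (voronoi D N a k) \<Longrightarrow> dist (a k) y \<le> B"
    using bounded_any_center[of _ "a k"] by blast
  then have "bdd_above ((\<lambda>y. norm (y - a k)) ` closure (voronoi D N a k))"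
    by (intro bdd_aboveI2[of _ _ B]) (simp add: dist_norm norm_minus_commute)
  then have "norm (a k - a k) \<le> (SUP y\<in>closure (voronoi D N a k). norm (y - a k))"
    using assms(3) closure_subset by (intro cSUP_upper) blast+
  also have "\<dots> \<le> cell_radius D N a"
    unfolding cell_radius_def using assms(2) by (intro Max_ge) auto
  finally show ?thesis
    by simp
qed

text \<open>
  The midpoint of two particles is equidistant from both of them and so lies in neither cell.
  Hence the disc cannot reach it, which places \<open>a k - a i\<close> outside the inner circle of the
  annulus.
\<close>

lemma particle_distance_ge:
  assumes "ball (a k) \<delta> \<subseteq> voronoi D N a k" "i \<in> {1..N}" "i \<noteq> k"
  shows "2 * \<delta> \<le> norm (a k - a i)"
proof (rule ccontr)
  assume "\<not> 2 * \<delta> \<le> norm (a k - a i)"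
  then have "midpoint (a k) (a i) \<in> ball (a k) \<delta>"
    by (simp add: dist_midpoint) (simp add: dist_norm)
  then have "midpoint (a k) (a i) \<in> voronoi D N a k"
    using assms(1) by blast
  then have "dist (midpoint (a k) (a i)) (a k) < dist (midpoint (a k) (a i)) (a i)"
    using assms(2,3) by (auto simp: voronoi_def dist_norm)
  then show False
    by (simp add: dist_midpoint)
qed

lemma open_annulus: "open (annulus r l x)"
  unfolding annulus_def by (intro open_Collect_conj open_Collect_less continuous_intros)

section \<open>Signs of volumes, integrals and weights\<close>

lemma particle_volume_nonneg: "0 \<le> particle_volume D N a h \<delta> i x"
  unfolding particle_volume_def set_lebesgue_integral_def by (intro Bochner_Integration.integral_nonneg) auto

lemma L1_norm_nonneg: "0 \<le> L1_norm U g"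
  unfolding L1_norm_def set_lebesgue_integral_def by (intro Bochner_Integration.integral_nonneg) auto

lemma weight_function_nonneg:
  assumes "weight_function D N a k h \<delta> Lw w" "x \<in> annulus h \<delta> 0"
  shows "0 \<le> w x"
proof (rule nonneg_of_AE_nonneg[where S = "annulus h \<delta> 0"])
  show "continuous_on (annulus h \<delta> 0) w"
    using assms(1) closure_subset by (auto simp: weight_function_def intro: continuous_on_subset)
  show "AE x in lebesgue. 0 \<le> w x"
    using assms(1) by (simp add: weight_function_def)
qed (use assms(2) open_annulus in auto)

section \<open>The error estimate\<close>

theorem theorem1p3:
  fixes \<Omega> :: "(real^2) set" and H h \<delta> Lw :: real and N k :: nat
    and a :: "nat \<Rightarrow> real^2" and w f :: "real^2 \<Rightarrow> real"
  defines "D \<equiv> enlarge \<Omega> H"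
  defines "r\<sigma> \<equiv> cell_radius D N a"
  assumes domain: "open \<Omega>" "connected \<Omega>" "\<Omega> \<noteq> {}" "bounded \<Omega>" and "H > 0"
    and particles: "a ` {1..N} \<subseteq> D" "inj_on a {1..N}"
    and radii: "r\<sigma> < H" "r\<sigma> < h" "h < H"
    and k: "k \<in> {1..N}" "a k \<in> voronoi D N a k \<inter> \<Omega>"
    and delta: "\<delta> > 0" "ball (a k) \<delta> \<subseteq> voronoi D N a k \<inter> \<Omega>"
    and inside: "\<And>x. x \<in> ball (a k) \<delta> \<Longrightarrow> ball x (h + r\<sigma>) \<subseteq> D"
    and weight: "weight_function D N a k h \<delta> Lw w"
    and f: "C1_closure D f"
  shows "\<bar>f (a k) - approx_op D N a k h \<delta> w f\<bar> \<le>
    (h + r\<sigma>) * C1_norm D f +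
    (2 * c1_const D N a k h \<delta> w + 2 * c2_const D N a k h Lw w) * C0_norm D f"
proof -
  have D: "open D" "bounded D"
    using domain open_enlarge bounded_enlarge by (auto simp: D_def)
  have "D \<noteq> {}"
    using particles k(1) by auto
  have "a k \<in> ball (a k) \<delta>"
    using delta(1) by simp
  have r: "0 \<le> r\<sigma>"
    unfolding r\<sigma>_def using D(2) k by (intro cell_radius_nonneg) auto
  let ?R = "neighbours N a k (a k) h"
  let ?p = "\<lambda>i. particle_volume D N a h \<delta> i (a k) * w (a k - a i)"
  have "0 \<le> ?p i" if "i \<in> ?R" for i
  proof -
    have i: "i \<in> {1..N}" "i \<noteq> k" "norm (a k - a i) < h"
      using that by (auto simp: neighbours_def)
    have "2 * \<delta> \<le> norm (a k - a i)"
      using delta(2) i(1,2) by (intro particle_distance_ge) auto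
    then have "a k - a i \<in> annulus h \<delta> 0"
      using i(3) delta(1) by (simp add: annulus_def)
    then show ?thesis
      using weight_function_nonneg[OF weight] by (simp add: particle_volume_nonneg)
  qed
  moreover have "0 < sum ?p ?R"
    using weight \<open>a k \<in> ball (a k) \<delta>\<close> unfolding weight_function_def by fastforce
  moreover have "\<bar>f (a k) - f (a i)\<bar> \<le> h * C1_norm D f" if "i \<in> ?R" for i
  proof -
    have near: "norm (a k - a i) < h"
      using that by (auto simp: neighbours_def)
    have "\<bar>f (a k) - f (a i)\<bar> \<le> C1_norm D f * norm (a k - a i)"
    proof (rule C1_norm_mean_value[OF f D])
      show "ball (a k) (h + r\<sigma>) \<subseteq> D"
        by (rule inside) fact
      show "a k \<in> ball (a k) (h + r\<sigma>)" "a i \<in> ball (a k) (h + r\<sigma>)"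
        using near r radii by (auto simp: dist_norm)
    qed simp
    also have "\<dots> \<le> C1_norm D f * h"
      using near C1_norm_nonneg[OF f D \<open>D \<noteq> {}\<close>] by (intro mult_left_mono) auto
    finally show ?thesis
      by (simp add: mult.commute)
  qed
  ultimately have "\<bar>f (a k) - (\<Sum>i\<in>?R. ?p i * f (a i)) / sum ?p ?R\<bar> \<le> h * C1_norm D f"
    by (rule weighted_mean_deviation)
  then have main: "\<bar>f (a k) - approx_op D N a k h \<delta> w f\<bar> \<le> h * C1_norm D f"
    by (simp add: approx_op_def mult_ac)
  have "0 \<le> Lw"
    using weight by (auto simp: weight_function_def lipschitz_on_def)
  then have "0 \<le> c2_const D N a k h Lw w"
    using r by (simp add: c2_const_def r\<sigma>_def L1_norm_nonneg)
  moreover have "0 \<le> c1_const D N a k h \<delta> w"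
    by (simp add: c1_const_def L1_norm_nonneg)
  moreover have "0 \<le> C0_norm D f"
    using f D(2) \<open>D \<noteq> {}\<close> by (intro C0_norm_nonneg) (auto simp: C1_closure_def)
  ultimately have "0 \<le> (2 * c1_const D N a k h \<delta> w + 2 * c2_const D N a k h Lw w) * C0_norm D f"
    by simp
  moreover have "h * C1_norm D f \<le> (h + r\<sigma>) * C1_norm D f"
    using r C1_norm_nonneg[OF f D \<open>D \<noteq> {}\<close>] by (intro mult_right_mono) auto
  ultimately show ?thesis
    using main by linarith
qed

end
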